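(* Let $W$ be an $\omega$-Stone space which is neither uniform nor scattered. Then $W=X\dotplus Y$ (with $X,Y$ disjoint clopen subsets of $W$), where $X$ is strongly uniform with $(K(X),r_X)\cong(K(W),r_W)$, and $Y$ is: (1) scattered of type $(\nu(W),0,n(W))$ if $\rho_U(W)=\rho(W)<\nu(W)$; (2) scattered of type $(\nu(W),\nu(W))$ if $\rho_U(W)<\rho(W)=\nu(W)$; (3) scattered of type $(\nu(W),\rho(W),n(W))$ if $\rho_U(W)<\rho(W)<\nu(W)$.
   Context: An $\omega$-Stone space is a locally compact metrisable totally disconnected Hausdorff space. For $S\subseteq W$, $S'$ is the derived set; $W^{(0)}=W$, $W^{(\xi+1)}=(W^{(\xi)})'$, $W^{(\eta)}=\bigcap_{\xi<\eta}W^{(\xi)}$ for limit $\eta$; $W^{[\xi]}=W^{(\xi)}-W^{(\xi+1)}$; $\nu(W)=\min\{\xi\mid W^{(\xi)}=W^{(\xi+1)}\}$; $K(W)=W^{(\nu(W))}$; $\lambda(W)=\min\{\xi\mid W^{(\xi)}-K(W)\text{ closed}\}$; $n(W)=|W^{(\mu)}-K(W)|$ if $\nu(W)=\mu+1$ and this is finite, else $-\infty$; $r_W(x)=\min\{\xi\mid x\notin\overline{W^{(\xi)}-K(W)}\}$ for $x\in K(W)$; $K_\xi(W)=\{w\in K(W)\mid r_W(w)>\xi\}$; $\rho(W)=\min\{\xi\mid\overline{W^{[\xi]}}\text{ compact}\}$; $\rho_U(W)=\min\{\xi\mid K_\xi(W)\text{ compact}\}$. $W$ is scattered if $K(W)=\emptyset$,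 uniform if $\nu(W)=\lambda(W)$, strongly uniform if uniform and $\rho_U(W)=\rho(W)$. A scattered $W$ has type $(\nu(W),\nu(W))$ if $\rho(W)=\nu(W)$, and type $(\nu(W),\rho(W),n(W))$ otherwise. $(U,r)\cong(V,s)$ means there is a homeomorphism $\phi\colon U\to V$ with $s(\phi(u))=r(u)$ for all $u$. *)

theory Defs
  imports "HOL-Analysis.Analysis" "HOL-Library.Extended_Real"
begin

unbundle cardinal_syntax

section \<open>Ordinals\<close>

text \<open>
  The topological invariants below are ordinals attached to a space whose points lie in the
  type \<open>'a\<close>. All of them have cardinality at most \<open>max(|'a|, \<aleph>\<^sub>0)\<close>, so it suffices to have the
  ordinals of at most that cardinality, i.e. the initial segment of the ordinals given by the
  cardinal successor of \<open>|'a| + \<aleph>\<^sub>0\<close>. This segment is long enough for every decreasing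
  transfinite sequence of subsets of \<open>'a\<close> to become stationary
  (see \<open>derivative_stationary\<close>), and it has no largest element, so that
  successors always exist (the summand \<open>nat\<close> takes care of finite \<open>'a\<close>).
\<close>

typedef 'a ordinal = "Field (cardSuc |UNIV :: ('a + nat) set| )"
proof -
  have "Field (cardSuc |UNIV :: ('a + nat) set| ) \<noteq> {}"
    using cardSuc_finite[OF card_of_Card_order, of "UNIV :: ('a + nat) set"]
    by (metis Field_card_of finite.emptyI finite_Plus_UNIV_iff infinite_UNIV_nat)
  then show ?thesis by blast
qed

lemma ordinal_Well_order: "Well_order (cardSuc |UNIV :: ('a + nat) set| )"
  using cardSuc_Card_order[OF card_of_Card_order] card_order_on_well_order_on by blast

lemma ordinal_Field_infinite: "infinite (Field (cardSuc |UNIV :: ('a + nat) set| ))"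
  using cardSuc_finite[OF card_of_Card_order, of "UNIV :: ('a + nat) set"]
  by (metis Field_card_of finite_Plus_UNIV_iff infinite_UNIV_nat)

instantiation ordinal :: (type) linorder
begin

definition less_eq_ordinal :: "'a ordinal \<Rightarrow> 'a ordinal \<Rightarrow> bool" where
  "\<xi> \<le> \<eta> \<longleftrightarrow> (Rep_ordinal \<xi>, Rep_ordinal \<eta>) \<in> cardSuc |UNIV :: ('a + nat) set|"

definition less_ordinal :: "'a ordinal \<Rightarrow> 'a ordinal \<Rightarrow> bool" where
  "(\<xi> :: 'a ordinal) < \<eta> \<longleftrightarrow> \<xi> \<le> \<eta> \<and> \<xi> \<noteq> \<eta>"

instance
proof
  fix x y z :: "'a ordinal"
  let ?r = "cardSuc |UNIV :: ('a + nat) set|"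
  have lo: "Refl ?r" "trans ?r" "antisym ?r" "Total ?r"
    using ordinal_Well_order[where 'a = 'a]
    unfolding well_order_on_def linear_order_on_def partial_order_on_def preorder_on_def by auto
  show "x \<le> x"
    using lo(1) Rep_ordinal[of x] unfolding less_eq_ordinal_def refl_on_def by blast
  show "x \<le> z" if "x \<le> y" "y \<le> z"
    using that lo(2) unfolding less_eq_ordinal_def trans_def by blast
  show anti: "x = y" if "x \<le> y" "y \<le> x"
    using that lo(3) unfolding less_eq_ordinal_def antisym_def by (metis Rep_ordinal_inject)
  show "x < y \<longleftrightarrow> x \<le> y \<and> \<not> y \<le> x"
    using anti \<open>x \<le> x\<close> unfolding less_ordinal_def by blast
  show "x \<le> y \<or> y \<le> x"
    using lo(4) Rep_ordinal[of x] Rep_ordinal[of y] \<open>x \<le> x\<close>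
    unfolding less_eq_ordinal_def total_on_def by (metis Rep_ordinal_inject)
qed

end

instance ordinal :: (type) wellorder
proof
  fix P :: "'a ordinal \<Rightarrow> bool" and a
  assume step: "\<And>x. (\<And>y. y < x \<Longrightarrow> P y) \<Longrightarrow> P x"
  let ?r = "cardSuc |UNIV :: ('a + nat) set|"
  have "wf (?r - Id)"
    using ordinal_Well_order[where 'a = 'a] unfolding well_order_on_def by blast
  then have "wf (inv_image (?r - Id) Rep_ordinal)"
    by (rule wf_inv_image)
  moreover have "inv_image (?r - Id) Rep_ordinal = {(x :: 'a ordinal, y). x < y}"
    by (auto simp: inv_image_def less_ordinal_def less_eq_ordinal_def Rep_ordinal_inject)
  ultimately have "wf {(x :: 'a ordinal, y). x < y}" by simp
  then show "P a"
    by (induction a rule: wf_induct_rule) (use step in blast)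
qed

instantiation ordinal :: (type) zero
begin
definition zero_ordinal :: "'a ordinal" where "(0 :: 'a ordinal) = (LEAST \<xi>. True)"
instance ..
end

definition osucc :: "'a ordinal \<Rightarrow> 'a ordinal" where
  "osucc \<xi> = (LEAST \<eta>. \<xi> < \<eta>)"

definition is_osucc :: "'a ordinal \<Rightarrow> bool" where
  "is_osucc \<xi> \<longleftrightarrow> (\<exists>\<eta>. \<xi> = osucc \<eta>)"

definition opred :: "'a ordinal \<Rightarrow> 'a ordinal" where
  "opred \<xi> = (THE \<eta>. \<xi> = osucc \<eta>)"

lemma ordinal_zero_le [simp]: "0 \<le> (\<xi> :: 'a ordinal)"
  unfolding zero_ordinal_def by (rule Least_le) simp

lemma ordinal_le_zero_iff [simp]: "\<xi> \<le> 0 \<longleftrightarrow> \<xi> = (0 :: 'a ordinal)"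
  using ordinal_zero_le[of \<xi>] by (auto intro: antisym)

lemma ordinal_no_max: "\<exists>\<eta> :: 'a ordinal. \<xi> < \<eta>"
proof -
  let ?r = "cardSuc |UNIV :: ('a + nat) set|"
  obtain b where "b \<in> Field ?r" "Rep_ordinal \<xi> \<noteq> b" "(Rep_ordinal \<xi>, b) \<in> ?r"
    using infinite_Card_order_limit[OF cardSuc_Card_order[OF card_of_Card_order]
        ordinal_Field_infinite Rep_ordinal[of \<xi>]] by blast
  then have "\<xi> < Abs_ordinal b"
    by (auto simp: less_ordinal_def less_eq_ordinal_def Abs_ordinal_inverse)
  then show ?thesis ..
qed

lemma less_osucc: "\<xi> < osucc \<xi>"
  unfolding osucc_def using ordinal_no_max by (rule LeastI_ex)

lemma osucc_le: "\<xi> < \<eta> \<Longrightarrow> osucc \<xi> \<le> \<eta>"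
  unfolding osucc_def by (rule Least_le)

lemma osucc_inject [simp]: "osucc \<xi> = osucc \<eta> \<longleftrightarrow> \<xi> = \<eta>"
  by (metis less_osucc linorder_neqE not_less osucc_le)

lemma osucc_neq_zero [simp]: "osucc \<xi> \<noteq> 0"
  by (metis less_osucc not_less ordinal_zero_le)

lemma is_osucc_osucc [simp]: "is_osucc (osucc \<xi>)"
  by (auto simp: is_osucc_def)

lemma opred_osucc [simp]: "opred (osucc \<xi>) = \<xi>"
  by (auto simp: opred_def)

lemma opred_less: "is_osucc \<xi> \<Longrightarrow> opred \<xi> < \<xi>"
  by (auto simp: is_osucc_def less_osucc)

section \<open>Spaces\<close>

text \<open>Second countability is not required.\<close>

definition totally_disconnected_space :: "'a topology \<Rightarrow> bool" where
  "totally_disconnected_space W \<longleftrightarrow>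
     (\<forall>x\<in>topspace W. connected_component_of_set W x = {x})"

definition omega_Stone_space :: "'a topology \<Rightarrow> bool" where
  "omega_Stone_space W \<longleftrightarrow>
     locally_compact_space W \<and> metrizable_space W \<and>
     totally_disconnected_space W \<and> Hausdorff_space W"

section \<open>Cantor-Bendixson derivatives and invariants\<close>

function derivative :: "'a topology \<Rightarrow> 'a ordinal \<Rightarrow> 'a set" where
  "derivative W \<xi> =
     (if \<xi> = 0 then topspace W
      else if is_osucc \<xi> then W derived_set_of (derivative W (opred \<xi>))
      else (\<Inter>\<eta>\<in>{..<\<xi>}. derivative W \<eta>))"
  by auto
termination
  by (relation "inv_image {(\<xi>, \<eta>). \<xi> < \<eta>} snd") (auto simp: opred_less wf)

declare derivative.simps [simp del]

lemma derivative_zero: "derivative W 0 = topspace W"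
  by (simp add: derivative.simps)

lemma derivative_osucc: "derivative W (osucc \<xi>) = W derived_set_of (derivative W \<xi>)"
  by (simp add: derivative.simps[of W "osucc \<xi>"])

lemma derivative_limit:
  "\<eta> \<noteq> 0 \<Longrightarrow> \<not> is_osucc \<eta> \<Longrightarrow> derivative W \<eta> = (\<Inter>\<xi>\<in>{..<\<eta>}. derivative W \<xi>)"
  by (subst derivative.simps) simp

lemma derivative_closed_antimono:
  assumes "Hausdorff_space W"
  shows "closedin W (derivative W \<xi>) \<and> (\<forall>\<eta>\<le>\<xi>. derivative W \<xi> \<subseteq> derivative W \<eta>)"
proof (induction \<xi> rule: less_induct)
  case (less \<xi>)
  consider "\<xi> = 0" | \<zeta> where "\<xi> = osucc \<zeta>" | "\<xi> \<noteq> 0" "\<not> is_osucc \<xi>"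
    unfolding is_osucc_def by blast
  then show ?case
  proof cases
    case 1
    then show ?thesis by (auto simp: derivative_zero)
  next
    case 2
    have cl: "closedin W (derivative W \<zeta>)" and sub: "\<forall>\<eta>\<le>\<zeta>. derivative W \<zeta> \<subseteq> derivative W \<eta>"
      using less.IH[of \<zeta>] by (auto simp: 2 less_osucc)
    have "derivative W \<xi> \<subseteq> derivative W \<zeta>"
      using cl by (simp add: 2 derivative_osucc closedin_contains_derived_set)
    moreover have "\<eta> = \<xi> \<or> \<eta> \<le> \<zeta>" if "\<eta> \<le> \<xi>" for \<eta>
      using that 2 by (metis antisym not_le osucc_le)
    ultimately have "\<forall>\<eta>\<le>\<xi>. derivative W \<xi> \<subseteq> derivative W \<eta>"
      using sub by blast
    moreover have "closedin W (derivative W \<xi>)"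
      using assms by (simp add: 2 derivative_osucc closedin_derived_set_of Hausdorff_imp_t1_space)
    ultimately show ?thesis by blast
  next
    case 3
    then have D: "derivative W \<xi> = (\<Inter>\<eta>\<in>{..<\<xi>}. derivative W \<eta>)"
      by (rule derivative_limit)
    have "0 < \<xi>" using 3 by (simp add: order_less_le)
    then have "closedin W (derivative W \<xi>)"
      unfolding D using less.IH by (intro closedin_Inter) auto
    moreover have "\<forall>\<eta>\<le>\<xi>. derivative W \<xi> \<subseteq> derivative W \<eta>"
      using D by (auto simp: order_le_less)
    ultimately show ?thesis by blast
  qed
qed

lemma derivative_stationary:
  assumes "Hausdorff_space (W :: 'a topology)"
  shows "\<exists>\<xi>. derivative W \<xi> = derivative W (osucc \<xi>)"
proof (rule ccontr)
  assume "\<nexists>\<xi>. derivative W \<xi> = derivative W (osucc \<xi>)"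
  moreover have "derivative W (osucc \<xi>) \<subseteq> derivative W \<xi>" for \<xi>
    using derivative_closed_antimono[OF assms] less_osucc by (meson less_imp_le)
  ultimately have "\<forall>\<xi>. \<exists>x. x \<in> derivative W \<xi> - derivative W (osucc \<xi>)"
    by blast
  then obtain f where f: "\<And>\<xi>. f \<xi> \<in> derivative W \<xi> - derivative W (osucc \<xi>)"
    by metis
  have "f \<xi> \<noteq> f \<eta>" if "\<xi> < \<eta>" for \<xi> \<eta>
    using f[of \<xi>] f[of \<eta>] derivative_closed_antimono[OF assms, of \<eta>] osucc_le[OF that] by (metis Diff_iff subsetD)
  then have "inj f"
    by (metis injI linorder_neqE)
  let ?c = "|UNIV :: ('a + nat) set|"
  have "inj_on (Inl \<circ> f \<circ> Abs_ordinal) (Field (cardSuc ?c))"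
    using \<open>inj f\<close> by (simp add: inj_on_def) (metis Abs_ordinal_inverse)
  then have "|Field (cardSuc ?c)| \<le>o ?c"
    using card_of_ordLeq by blast
  moreover have "|Field (cardSuc ?c)| =o cardSuc ?c"
    by (rule card_of_Field_ordIso[OF cardSuc_Card_order[OF card_of_Card_order]])
  moreover have "?c <o cardSuc ?c"
    by (rule cardSuc_greater[OF card_of_Card_order])
  ultimately show False
    by (meson not_ordLess_ordIso not_ordLess_ordLeq ordIso_ordLeq_trans ordIso_symmetric)
qed

text \<open>
  Each \<open>LEAST\<close> below is a minimum over a nonempty set of ordinals when \<open>W\<close> is Hausdorff: for \<open>nu\<close> this
  is \<open>derivative_stationary\<close>, and in the other cases \<open>nu W\<close> itself is a witness, because
  \<open>derivative W (nu W) - perfect_kernel W\<close> and \<open>layer W (nu W)\<close> are empty.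
\<close>

definition layer :: "'a topology \<Rightarrow> 'a ordinal \<Rightarrow> 'a set" where
  "layer W \<xi> = derivative W \<xi> - derivative W (osucc \<xi>)"

definition nu :: "'a topology \<Rightarrow> 'a ordinal" where
  "nu W = (LEAST \<xi>. derivative W \<xi> = derivative W (osucc \<xi>))"

definition perfect_kernel :: "'a topology \<Rightarrow> 'a set" where
  "perfect_kernel W = derivative W (nu W)"

definition lam :: "'a topology \<Rightarrow> 'a ordinal" where
  "lam W = (LEAST \<xi>. closedin W (derivative W \<xi> - perfect_kernel W))"

definition top_count :: "'a topology \<Rightarrow> ereal" where
  "top_count W =
     (if is_osucc (nu W) \<and> finite (derivative W (opred (nu W)) - perfect_kernel W)
      then ereal (real (card (derivative W (opred (nu W)) - perfect_kernel W)))
      else -\<infinity>)"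

text \<open>\<open>rnk W x\<close> is only meaningful for \<open>x \<in> perfect_kernel W\<close>.\<close>

definition rnk :: "'a topology \<Rightarrow> 'a \<Rightarrow> 'a ordinal" where
  "rnk W x = (LEAST \<xi>. x \<notin> W closure_of (derivative W \<xi> - perfect_kernel W))"

definition perfect_kernel_above :: "'a topology \<Rightarrow> 'a ordinal \<Rightarrow> 'a set" where
  "perfect_kernel_above W \<xi> = {w \<in> perfect_kernel W. rnk W w > \<xi>}"

definition rho :: "'a topology \<Rightarrow> 'a ordinal" where
  "rho W = (LEAST \<xi>. compactin W (W closure_of (layer W \<xi>)))"

definition rho_U :: "'a topology \<Rightarrow> 'a ordinal" where
  "rho_U W = (LEAST \<xi>. compactin W (perfect_kernel_above W \<xi>))"

definition scattered :: "'a topology \<Rightarrow> bool" where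
  "scattered W \<longleftrightarrow> perfect_kernel W = {}"

definition uniform :: "'a topology \<Rightarrow> bool" where
  "uniform W \<longleftrightarrow> nu W = lam W"

definition strongly_uniform :: "'a topology \<Rightarrow> bool" where
  "strongly_uniform W \<longleftrightarrow> uniform W \<and> rho_U W = rho W"

datatype 'a space_type =
    Type_Pair "'a ordinal" "'a ordinal"
  | Type_Triple "'a ordinal" "'a ordinal" ereal

definition scattered_type :: "'a topology \<Rightarrow> 'a space_type" where
  "scattered_type W =
     (if rho W = nu W then Type_Pair (nu W) (nu W) else Type_Triple (nu W) (rho W) (top_count W))"

definition has_scattered_type :: "'a topology \<Rightarrow> 'a space_type \<Rightarrow> bool" where
  "has_scattered_type W t \<longleftrightarrow> scattered W \<and> scattered_type W = t"

definition ranked_homeomorphic ::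
  "'a topology \<Rightarrow> ('a \<Rightarrow> 'c) \<Rightarrow> 'b topology \<Rightarrow> ('b \<Rightarrow> 'c) \<Rightarrow> bool" where
  "ranked_homeomorphic U r V s \<longleftrightarrow>
     (\<exists>\<phi>. homeomorphic_map U V \<phi> \<and> (\<forall>u\<in>topspace U. s (\<phi> u) = r u))"

end

theory Submission
  imports Defs
begin

text \<open>
  Write \<open>K = K(W)\<close>, \<open>D\<^sub>\<xi> = W\<^sup>(\<^sup>\<xi>\<^sup>) - K\<close> and \<open>F\<^sub>\<xi>\<close> for the closure of \<open>D\<^sub>\<xi>\<close>. All invariants can be read off from these
  sets: \<open>F\<^sub>\<xi>\<close> is also the closure of the layer \<open>\<xi>\<close>, and \<open>K\<^sub>\<xi>(W) = K \<inter> F\<^sub>\<xi>\<close>. They restrict to open subspaces, so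
  for every clopen \<open>X \<supseteq> K\<close> the ranks, \<open>\<lambda>\<close> and \<open>\<rho>\<^sub>U\<close> are those of \<open>W\<close>; moreover \<open>X\<close> is uniform iff it
  misses the closed set \<open>D\<^sub>\<lambda>\<close>, and strongly uniform as soon as in addition \<open>X \<inter> F\<^sub>\<xi>\<close> is compact for \<open>\<xi> = \<rho>\<^sub>U(W)\<close>.
  If \<open>\<rho>\<^sub>U(W) = \<rho>(W)\<close> then \<open>F\<^sub>\<xi>\<close> is compact, and the complement \<open>Y\<close> of \<open>X\<close> can be chosen as a compact open set
  between \<open>D\<^sub>\<lambda>\<close> and \<open>W - K\<close>. Otherwise take a compact open \<open>V \<supseteq> K \<inter> F\<^sub>\<xi>\<close> and separate \<open>K\<close> from
  \<open>D\<^sub>\<lambda> \<union> (F\<^sub>\<xi> - V)\<close>; then \<open>\<rho>(X) < \<rho>(W)\<close> forces \<open>\<rho>(Y) = \<rho>(W)\<close>.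
\<close>

section \<open>Separation by clopen sets\<close>


text \<open>In a locally compact Hausdorff space a compact component has arbitrarily small clopen
  neighbourhoods. Here \<open>{x}\<close> is a component, and a clopen set inside an open
  \<open>N\<close> with compact closure is compact.\<close>

lemma omega_Stone_compact_open_nbhd:
  assumes W: "omega_Stone_space W" and U: "openin W U" "x \<in> U"
  obtains G where "openin W G" "compactin W G" "x \<in> G" "G \<subseteq> U"
proof -
  have W': "locally_compact_space W" "Hausdorff_space W" "totally_disconnected_space W"
    using W by (auto simp: omega_Stone_space_def)
  have x: "x \<in> topspace W"
    using U openin_subset by blast
  then obtain N where N: "openin W N" "compactin W (W closure_of N)" "x \<in> N"
    using W' locally_compact_space_compact_closure_of by blast
  have "{x} \<in> connected_components_of W"
    using W' x unfolding totally_disconnected_space_def connected_components_of_def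
    by (metis image_eqI)
  then obtain G V where GV: "openin W G" "openin W V" "disjnt G V" "G \<union> V = topspace W" "{x} \<subseteq> G"
      "G \<subseteq> U \<inter> N"
    using wilder_locally_compact_component_thm[OF W'(1,2), of "{x}" "U \<inter> N"] x U N by auto
  have "G = topspace W - V"
    using GV(3,4) by (auto simp: disjnt_iff)
  then have "closedin W G"
    using GV(2) by auto
  moreover have "G \<subseteq> W closure_of N"
    using GV(6) closure_of_subset[OF openin_subset[OF N(1)]] by auto
  ultimately have "compactin W G"
    using N(2) closed_compactin by blast
  then show thesis
    using that GV by auto
qed

lemma omega_Stone_compact_open_between:
  assumes W: "omega_Stone_space W" and C: "compactin W C" and U: "openin W U" "C \<subseteq> U"
  obtains G where "openin W G" "compactin W G" "C \<subseteq> G" "G \<subseteq> U"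
proof -
  let ?\<G> = "{G. openin W G \<and> compactin W G \<and> G \<subseteq> U}"
  have "C \<subseteq> \<Union>?\<G>"
  proof
    fix x assume "x \<in> C"
    then have "x \<in> U" using U by blast
    then show "x \<in> \<Union>?\<G>"
      using omega_Stone_compact_open_nbhd[OF W U(1)] by blast
  qed
  then obtain \<F> where \<F>: "finite \<F>" "\<F> \<subseteq> ?\<G>" "C \<subseteq> \<Union>\<F>"
    using compactinD[OF C, of ?\<G>] by blast
  show thesis
  proof (rule that)
    show "openin W (\<Union>\<F>)" using \<F> by blast
    show "compactin W (\<Union>\<F>)" using \<F> by (intro compactin_Union) auto
    show "C \<subseteq> \<Union>\<F>" by (rule \<F>(3))
    show "\<Union>\<F> \<subseteq> U" using \<F>(2) by blast
  qed
qed

text \<open>The radius of local compactness, truncated at 1 so that the supremum exists. It is a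
  1-Lipschitz function, so one step of length below a quarter of it leads from a compact set into a compact set. Hence the
  classes of the chain relation are open and \<open>\<sigma>\<close>-compact, which replaces separability.\<close>

definition (in Metric_space) compact_radius :: "'a \<Rightarrow> real" where
  "compact_radius x = Sup {r. 0 < r \<and> r \<le> 1 \<and> compactin mtopology (mcball x r)}"

section \<open>Chain classes in a locally compact metric space\<close>

context Metric_space
begin

lemma compact_radius_nonempty:
  assumes "locally_compact_space mtopology" "x \<in> M"
  shows "\<exists>r. 0 < r \<and> r \<le> 1 \<and> compactin mtopology (mcball x r)"
proof -
  obtain U K where UK: "openin mtopology U" "compactin mtopology K" "x \<in> U" "U \<subseteq> K"
    using assms unfolding locally_compact_space_def by auto
  then obtain r where r: "0 < r" "mcball x r \<subseteq> U"
    using openin_mtopology_mcball by blast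
  have "compactin mtopology (mcball x (min r 1))"
  proof (rule closed_compactin[OF UK(2)])
    show "mcball x (min r 1) \<subseteq> K"
      using r UK(4) mcball_subset_concentric[of "min r 1" r x] by auto
  qed simp
  then show ?thesis using r by (intro exI[of _ "min r 1"]) auto
qed

lemma compact_radius_upper: "0 < r \<Longrightarrow> r \<le> 1 \<Longrightarrow> compactin mtopology (mcball x r) \<Longrightarrow> r \<le> compact_radius x"
  unfolding compact_radius_def by (rule cSup_upper) (auto intro!: bdd_aboveI[of _ 1])

lemma compact_radius_pos:
  assumes "locally_compact_space mtopology" "x \<in> M"
  shows "0 < compact_radius x"
  using compact_radius_nonempty[OF assms] compact_radius_upper by (meson less_le_trans)

lemma compact_radius_lessD:
  assumes "locally_compact_space mtopology" "x \<in> M" "s < compact_radius x"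
  shows "compactin mtopology (mcball x s)"
proof -
  obtain r where "s < r" "compactin mtopology (mcball x r)"
    using assms compact_radius_nonempty[OF assms(1,2)] unfolding compact_radius_def
    by (subst (asm) less_cSup_iff) (auto intro!: bdd_aboveI[of _ 1])
  then show ?thesis
    using closed_compactin[OF _ mcball_subset_concentric closedin_mcball] by (meson less_imp_le)
qed

lemma compact_radius_le_1:
  assumes "locally_compact_space mtopology" "x \<in> M"
  shows "compact_radius x \<le> 1"
  unfolding compact_radius_def using compact_radius_nonempty[OF assms] by (intro cSup_least) auto

text \<open>For \<open>s\<close> below the radius at \<open>x\<close>, the ball about
  \<open>y\<close> of radius \<open>s - d x y\<close> lies in a compact ball about \<open>x\<close>.
  Since \<open>s\<close> is at most 1, the truncation does not interfere.\<close>

lemma compact_radius_Lipschitz: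
  assumes lc: "locally_compact_space mtopology" and x: "x \<in> M" and y: "y \<in> M"
  shows "compact_radius x \<le> compact_radius y + d x y"
proof (rule ccontr)
  assume "\<not> ?thesis"
  then obtain s where s: "compact_radius y + d x y < s" "s < compact_radius x"
    using dense by (metis not_le)
  have "compactin mtopology (mcball y (s - d x y))"
  proof (rule closed_compactin)
    show "compactin mtopology (mcball x s)"
      by (rule compact_radius_lessD[OF lc x s(2)])
    show "mcball y (s - d x y) \<subseteq> mcball x s"
      by (rule mcball_subset) (auto simp: commute x)
  qed simp
  moreover have "0 < s - d x y" "s - d x y \<le> 1"
    using s compact_radius_le_1[OF lc x] compact_radius_pos[OF lc y] nonneg[of x y] by linarith+
  ultimately have "s - d x y \<le> compact_radius y"
    by (rule compact_radius_upper[rotated 2])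
  then show False using s by linarith
qed

text \<open>Bounding the step by the radius at both ends makes the relation symmetric, so that its
  reflexive transitive closure partitions \<open>M\<close>.\<close>

definition chain_step :: "'a \<Rightarrow> 'a \<Rightarrow> bool" where
  "chain_step x y \<longleftrightarrow> x \<in> M \<and> y \<in> M \<and> d x y < compact_radius x / 4 \<and> d x y < compact_radius y / 4"

lemma chain_step_sym: "chain_step x y \<Longrightarrow> chain_step y x"
  by (auto simp: chain_step_def commute)

lemma chain_step_compact:
  assumes lc: "locally_compact_space mtopology" and C: "compactin mtopology C"
  shows "\<exists>C'. compactin mtopology C' \<and> (\<forall>x\<in>C. \<forall>y. chain_step x y \<longrightarrow> y \<in> C')"
proof -
  let ?B = "\<lambda>x. mball x (compact_radius x / 4)"
  have CM: "C \<subseteq> M"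
    using C compactin_subset_topspace by fastforce
  then have "C \<subseteq> \<Union>(?B ` C)"
    using compact_radius_pos[OF lc] by fastforce
  then obtain \<F> where \<F>: "finite \<F>" "\<F> \<subseteq> ?B ` C" "C \<subseteq> \<Union>\<F>"
    using compactinD[OF C, of "?B ` C"] by auto
  then obtain F where F: "finite F" "F \<subseteq> C" "\<F> = ?B ` F"
    using finite_subset_image[OF \<F>(1,2)] by blast
  \<comment> \<open>If R is the radius at the centre z, the Lipschitz bound gives radius at most 5/4
    R at x, so a step from x has length below 5/16 R. Adding \<open>d z x\<close> < 1/4 R gives 9/16
    R, which is below R, so these finitely many balls are compact.\<close>
  let ?C' = "\<Union>x\<in>F. mcball x (9 / 16 * compact_radius x)"
  have "compactin mtopology ?C'"
  proof (intro compactin_Union; clarsimp simp: F)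
    fix x assume "x \<in> F"
    then have "x \<in> M" using F CM by blast
    then show "compactin mtopology (mcball x (9 * compact_radius x / 16))"
      using compact_radius_pos[OF lc, of x] by (intro compact_radius_lessD[OF lc]) auto
  qed
  moreover have "y \<in> ?C'" if xy: "x \<in> C" "chain_step x y" for x y
  proof -
    obtain z where z: "z \<in> F" "x \<in> ?B z"
      using \<F>(3) F(3) xy(1) by auto
    have m: "x \<in> M" "y \<in> M" "z \<in> M" "d x y < compact_radius x / 4" "d z x < compact_radius z / 4"
      using xy z by (auto simp: chain_step_def)
    then have "d z y \<le> 9 / 16 * compact_radius z"
      using compact_radius_Lipschitz[OF lc m(1) m(3)] triangle[OF m(3,1,2)] commute[of x z] by linarith
    then show ?thesis
      using m z by auto
  qed
  ultimately show ?thesis by blast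
qed

lemma openin_chain_class:
  assumes lc: "locally_compact_space mtopology" and x: "x \<in> M"
  shows "openin mtopology {y. chain_step\<^sup>*\<^sup>* x y}"
  unfolding openin_mtopology
proof (intro conjI allI impI)
  have "y \<in> M" if "chain_step\<^sup>*\<^sup>* x y" for y
    using that by (induction rule: rtranclp_induct) (auto simp: x chain_step_def)
  then show sub: "{y. chain_step\<^sup>*\<^sup>* x y} \<subseteq> M"
    by blast
  fix y assume y: "y \<in> {y. chain_step\<^sup>*\<^sup>* x y}"
  then have yM: "y \<in> M" using sub by blast
  have pos: "0 < compact_radius y" by (rule compact_radius_pos[OF lc yM])
  \<comment> \<open>Within R/8 of y, where R is the radius at y, the radius is still at least 7/8 R,
    and a quarter of that exceeds R/8.\<close>
  have "chain_step y z" if "z \<in> mball y (compact_radius y / 8)" for z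
    using that compact_radius_Lipschitz[OF lc yM, of z] pos by (auto simp: chain_step_def)
  then have "mball y (compact_radius y / 8) \<subseteq> {y. chain_step\<^sup>*\<^sup>* x y}"
    using y by (auto intro: rtranclp.rtrancl_into_rtrancl)
  then show "\<exists>r>0. mball y r \<subseteq> {y. chain_step\<^sup>*\<^sup>* x y}"
    using pos by (intro exI[of _ "compact_radius y / 8"]) auto
qed

text \<open>Starting from \<open>{x}\<close>, each compact set is followed by a compact set that
  receives all steps out of it, so a point reached in n steps lies in \<open>C n\<close>. The clause
  for \<open>n = 0\<close> fixes the start inside the dependent choice.\<close>

lemma chain_class_sigma_compact:
  assumes lc: "locally_compact_space mtopology" and x: "x \<in> M"
  shows "\<exists>C :: nat \<Rightarrow> 'a set. (\<forall>n. compactin mtopology (C n)) \<and> {y. chain_step\<^sup>*\<^sup>* x y} \<subseteq> (\<Union>n. C n)"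
proof -
  have "\<exists>C :: nat \<Rightarrow> 'a set. \<forall>n. (compactin mtopology (C n) \<and> (n = 0 \<longrightarrow> C n = {x})) \<and>
      (\<forall>u\<in>C n. \<forall>y. chain_step u y \<longrightarrow> y \<in> C (Suc n))"
    by (rule dependent_nat_choice) (use x chain_step_compact[OF lc] in auto)
  then obtain C :: "nat \<Rightarrow> 'a set" where C: "\<And>n. compactin mtopology (C n)" "C 0 = {x}"
      "\<And>n u y. u \<in> C n \<Longrightarrow> chain_step u y \<Longrightarrow> y \<in> C (Suc n)"
    by metis
  have "y \<in> (\<Union>n. C n)" if "chain_step\<^sup>*\<^sup>* x y" for y
    using that
  proof (induction rule: rtranclp_induct)
    case base
    show ?case using C(2) by blast
  next
    case (step u v)
    then obtain n where "u \<in> C n" by blast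
    then have "v \<in> C (Suc n)" using step(2) by (rule C(3))
    then show ?case by blast
  qed
  then show ?thesis using C(1) by (intro exI[of _ C] conjI) auto
qed

lemma chain_partition:
  assumes lc: "locally_compact_space mtopology"
  defines "\<E> \<equiv> (\<lambda>x. {y. chain_step\<^sup>*\<^sup>* x y}) ` M"
  shows "\<Union>\<E> = M" "disjoint \<E>"
proof -
  have "openin mtopology E" if "E \<in> \<E>" for E
    using that openin_chain_class[OF lc] by (auto simp: \<E>_def)
  then have "E \<subseteq> M" if "E \<in> \<E>" for E
    using that openin_subset by fastforce
  then show "\<Union>\<E> = M"
    by (auto simp: \<E>_def)
  have sym: "chain_step\<^sup>*\<^sup>* y x" if "chain_step\<^sup>*\<^sup>* x y" for x y
    using that by (induction rule: rtranclp_induct)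
      (auto intro: chain_step_sym converse_rtranclp_into_rtranclp)
  have "{z. chain_step\<^sup>*\<^sup>* x z} = {z. chain_step\<^sup>*\<^sup>* y z}"
    if "chain_step\<^sup>*\<^sup>* x w" "chain_step\<^sup>*\<^sup>* y w" for x y w
    using rtranclp_trans[OF that(1) sym[OF that(2)]] rtranclp_trans[OF that(2) sym[OF that(1)]]
    by (auto intro: rtranclp_trans)
  then show "disjoint \<E>"
    unfolding \<E>_def disjoint_def by blast
qed

end

section \<open>Open partitions and clopen separation\<close>

text \<open>Each chain class is covered by countably many members of the cover. Subtracting from
  each the earlier ones, a finite union of closed sets, keeps it open and makes the pieces disjoint;
  distinct classes are open and disjoint already.\<close>

lemma omega_Stone_partition_refinement:
  assumes W: "omega_Stone_space W"
    and cover: "topspace W \<subseteq> \<Union>\<G>" "\<And>G. G \<in> \<G> \<Longrightarrow> openin W G \<and> closedin W G"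
  obtains \<H> where "\<And>H. H \<in> \<H> \<Longrightarrow> openin W H \<and> (\<exists>G\<in>\<G>. H \<subseteq> G)" "\<Union>\<H> = topspace W" "disjoint \<H>"
proof -
  obtain M d where "Metric_space M d" and Wd: "W = Metric_space.mtopology M d"
    using W by (auto simp: omega_Stone_space_def metrizable_space_def)
  then interpret Metric_space M d by blast
  have lc: "locally_compact_space mtopology"
    using W Wd by (auto simp: omega_Stone_space_def)
  define \<E> where "\<E> = (\<lambda>x. {y. chain_step\<^sup>*\<^sup>* x y}) ` M"
  note part = chain_partition[OF lc, folded \<E>_def]
  have "\<exists>G :: nat \<Rightarrow> 'a set. range G \<subseteq> \<G> \<and> E \<subseteq> (\<Union>n. G n)" if "E \<in> \<E>" for E
  proof -
    obtain x where x: "x \<in> M" "E = {y. chain_step\<^sup>*\<^sup>* x y}"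
      using \<open>E \<in> \<E>\<close> unfolding \<E>_def by blast
    obtain C where C: "\<And>n. compactin W (C n)" "E \<subseteq> (\<Union>n::nat. C n)"
      using chain_class_sigma_compact[OF lc x(1)] unfolding x(2) Wd by blast
    have "\<exists>\<F>. finite \<F> \<and> \<F> \<subseteq> \<G> \<and> C n \<subseteq> \<Union>\<F>" for n
      using cover compactin_subset_topspace[OF C(1)] by (intro compactinD[OF C(1)]) blast+
    then obtain \<F> where \<F>: "\<And>n. finite (\<F> n)" "\<And>n. \<F> n \<subseteq> \<G>" "\<And>n. C n \<subseteq> \<Union>(\<F> n)"
      by metis
    let ?A = "\<Union>n. \<F> n"
    have A: "countable ?A"
      using \<F>(1) by (simp add: countable_finite)
    have cov: "E \<subseteq> \<Union>?A"
    proof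
      fix z assume "z \<in> E"
      then obtain n where "z \<in> C n" using C(2) by auto
      then show "z \<in> \<Union>?A" using \<F>(3)[of n] by blast
    qed
    moreover have "x \<in> E" using x by simp
    ultimately obtain n where "x \<in> \<Union>(\<F> n)" by blast
    \<comment> \<open>\<open>from_nat_into\<close> enumerates exactly the given countable set only
      if that set is nonempty.\<close>
    then have "?A \<noteq> {}" by blast
    then have "range (from_nat_into ?A) = ?A"
      using A by (rule range_from_nat_into)
    then show ?thesis
      using \<F>(2) cov by (intro exI[of _ "from_nat_into ?A"]) auto
  qed
  then obtain G where G: "\<And>E n. E \<in> \<E> \<Longrightarrow> G E n \<in> \<G>" "\<And>E. E \<in> \<E> \<Longrightarrow> E \<subseteq> (\<Union>n::nat. G E n)"
    by (metis UNIV_I image_subset_iff)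
  define H where "H = (\<lambda>(E, n). E \<inter> disjointed (G E) n)"
  show thesis
  proof (rule that[of "H ` (\<E> \<times> UNIV)"])
    fix X assume "X \<in> H ` (\<E> \<times> UNIV)"
    then obtain E n where En: "E \<in> \<E>" "X = H (E, n)" by blast
    have E: "openin W E"
      using En(1) openin_chain_class[OF lc] by (auto simp: Wd \<E>_def)
    have G': "openin W (G E i)" "closedin W (G E i)" for i
      using G(1)[OF En(1)] cover(2) by blast+
    have "closedin W (\<Union>i\<in>{0..<n}. G E i)"
      by (rule closedin_Union) (use G' in auto)
    then have "openin W X"
      unfolding En(2) H_def disjointed_def using E G' by auto
    moreover have "X \<subseteq> G E n"
      unfolding En(2) H_def by (auto simp: disjointed_def)
    ultimately show "openin W X \<and> (\<exists>G\<in>\<G>. X \<subseteq> G)"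
      using G(1)[OF En(1)] by blast
  next
    have "(\<Union>n. H (E, n)) = E" if "E \<in> \<E>" for E
      using G(2)[OF that] UN_disjointed_eq[of "G E"] by (auto simp: H_def)
    then have "(\<Union>E\<in>\<E>. \<Union>n. H (E, n)) = \<Union>\<E>"
      by simp
    moreover have "\<Union>(H ` (\<E> \<times> UNIV)) = (\<Union>E\<in>\<E>. \<Union>n. H (E, n))"
      by auto
    ultimately show "\<Union>(H ` (\<E> \<times> UNIV)) = topspace W"
      using part(1) by (simp add: Wd)
  next
    show "disjoint (H ` (\<E> \<times> UNIV))"
    proof (rule disjointI)
      fix X Y assume "X \<in> H ` (\<E> \<times> UNIV)" "Y \<in> H ` (\<E> \<times> UNIV)" and ne: "X \<noteq> Y"
      then obtain E n E' n' where En: "E \<in> \<E>" "X = H (E, n)" "E' \<in> \<E>" "Y = H (E', n')"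
        by blast
      show "X \<inter> Y = {}"
      proof (cases "E = E'")
        case True
        then have "n \<noteq> n'" using En ne by auto
        then have "disjointed (G E) n \<inter> disjointed (G E) n' = {}"
          using disjoint_family_disjointed[of "G E"] by (auto simp: disjoint_family_on_def)
        then show ?thesis
          using En True by (auto simp: H_def)
      next
        case False
        then have "E \<inter> E' = {}"
          using disjointD[OF part(2) En(1,3)] by blast
        then show ?thesis
          using En by (auto simp: H_def)
      qed
    qed
  qed
qed

text \<open>Compact open sets that miss \<open>A\<close> or miss \<open>B\<close> cover the space.
  In a refining open partition, the union of the cells meeting \<open>A\<close> is clopen because
  its complement is the union of the other cells.\<close>

lemma omega_Stone_clopen_separation:
  assumes W: "omega_Stone_space W" and A: "closedin W A" and B: "closedin W B" and AB: "A \<inter> B = {}"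
  obtains X where "openin W X" "closedin W X" "A \<subseteq> X" "X \<inter> B = {}"
proof -
  define \<G> where "\<G> = {G. openin W G \<and> closedin W G \<and> (A \<inter> G = {} \<or> B \<inter> G = {})}"
  have T2: "Hausdorff_space W"
    using W by (auto simp: omega_Stone_space_def)
  have "\<exists>G\<in>\<G>. x \<in> G" if x: "x \<in> topspace W" for x
  proof -
    obtain S where S: "S = A \<or> S = B" "x \<notin> S" "closedin W S"
      using A B AB by blast
    have "openin W (topspace W - S)" "x \<in> topspace W - S"
      using S x by auto
    from omega_Stone_compact_open_nbhd[OF W this]
    obtain G where "openin W G" "compactin W G" "x \<in> G" "G \<subseteq> topspace W - S"
      by blast
    then show ?thesis
      using S(1) compactin_imp_closedin[OF T2] by (intro bexI[of _ G]) (auto simp: \<G>_def)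
  qed
  then have cov: "topspace W \<subseteq> \<Union>\<G>" "\<And>G. G \<in> \<G> \<Longrightarrow> openin W G \<and> closedin W G"
    by (auto simp: \<G>_def)
  obtain \<H> where \<H>: "\<And>H. H \<in> \<H> \<Longrightarrow> openin W H \<and> (\<exists>G\<in>\<G>. H \<subseteq> G)" "\<Union>\<H> = topspace W" "disjoint \<H>"
    using omega_Stone_partition_refinement[OF W cov] by blast
  define P where "P = \<Union>{H\<in>\<H>. A \<inter> H \<noteq> {}}"
  define Q where "Q = \<Union>{H\<in>\<H>. A \<inter> H = {}}"
  have "P \<inter> Q = {}"
    using \<H>(3) unfolding disjoint_def P_def Q_def by fastforce
  moreover have PQ: "P \<union> Q = topspace W"
    unfolding \<H>(2)[symmetric] P_def Q_def by blast
  ultimately have "topspace W - P = Q"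
    by auto
  moreover have "openin W Q" "openin W P"
    using \<H>(1) by (auto simp: P_def Q_def)
  ultimately have "openin W P" "closedin W P"
    using PQ by (auto simp: closedin_def)
  moreover have "A \<subseteq> P"
    using closedin_subset[OF A] unfolding \<H>(2)[symmetric] P_def by blast
  \<comment> \<open>A cell meeting \<open>A\<close> lies in a member of the cover that meets
    \<open>A\<close>, and such a member misses \<open>B\<close>.\<close>
  moreover have "H \<inter> B = {}" if "H \<in> \<H>" "A \<inter> H \<noteq> {}" for H
    using \<H>(1)[OF that(1)] that(2) unfolding \<G>_def by blast
  then have "P \<inter> B = {}"
    by (auto simp: P_def)
  ultimately show thesis
    using that by blast
qed

section \<open>Derivatives of open subspaces\<close>


lemma derivative_antimono:
  assumes "Hausdorff_space W" "\<eta> \<le> \<xi>"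
  shows "derivative W \<xi> \<subseteq> derivative W \<eta>"
  using derivative_closed_antimono assms by blast

lemma closedin_derivative: "Hausdorff_space W \<Longrightarrow> closedin W (derivative W \<xi>)"
  using derivative_closed_antimono by blast

lemma derivative_stationary_above:
  assumes W: "Hausdorff_space W" and eq: "derivative W \<xi> = derivative W (osucc \<xi>)" and "\<xi> \<le> \<eta>"
  shows "derivative W \<eta> = derivative W \<xi>"
  using \<open>\<xi> \<le> \<eta>\<close>
proof (induction \<eta> rule: less_induct)
  case (less \<eta>)
  consider "\<eta> = \<xi>" | \<zeta> where "\<eta> = osucc \<zeta>" "\<xi> < \<eta>" | "\<eta> \<noteq> 0" "\<not> is_osucc \<eta>" "\<xi> < \<eta>"
    using less.prems unfolding is_osucc_def
    by (metis ordinal_le_zero_iff order_le_less)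
  then show ?case
  proof cases
    case 2
    have "\<xi> \<le> \<zeta>" using 2 by (metis not_le osucc_le)
    then have "derivative W \<zeta> = derivative W \<xi>"
      using less.IH[of \<zeta>] 2 less_osucc by blast
    then show ?thesis
      using eq 2(1) by (metis derivative_osucc)
  next
    case 3
    have "derivative W \<xi> \<subseteq> derivative W \<zeta>" if "\<zeta> < \<eta>" for \<zeta>
      using less.IH[of \<zeta>] that derivative_antimono[OF W, of \<zeta> \<xi>] by (metis le_cases order_refl)
    then show ?thesis
      using 3 derivative_limit[of \<eta> W] by auto
  qed simp
qed

lemma nu_stationary:
  assumes "Hausdorff_space W"
  shows "derivative W (nu W) = derivative W (osucc (nu W))"
  unfolding nu_def using derivative_stationary[OF assms] by (rule LeastI_ex)

lemma derivative_above_nu: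
  assumes "Hausdorff_space W" "nu W \<le> \<xi>"
  shows "derivative W \<xi> = perfect_kernel W"
  unfolding perfect_kernel_def using derivative_stationary_above[OF assms(1) nu_stationary] assms by blast

lemma perfect_kernel_subset_derivative:
  assumes "Hausdorff_space W"
  shows "perfect_kernel W \<subseteq> derivative W \<xi>"
  using derivative_above_nu[OF assms] derivative_antimono[OF assms, of \<xi> "nu W"]
  by (metis le_cases order_refl perfect_kernel_def)

lemma derivative_stationary_eq_perfect_kernel:
  assumes W: "Hausdorff_space W" and eq: "derivative W \<xi> = derivative W (osucc \<xi>)"
  shows "derivative W \<xi> = perfect_kernel W"
  by (metis W derivative_above_nu derivative_stationary_above eq le_cases perfect_kernel_def)

lemma nu_le_iff:
  assumes W: "Hausdorff_space W"
  shows "nu W \<le> \<xi> \<longleftrightarrow> derivative W \<xi> \<subseteq> perfect_kernel W"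
proof
  assume "derivative W \<xi> \<subseteq> perfect_kernel W"
  then have "derivative W \<xi> = derivative W (osucc \<xi>)"
    using perfect_kernel_subset_derivative[OF W] derivative_antimono[OF W less_imp_le[OF less_osucc]]
    by blast
  then show "nu W \<le> \<xi>"
    unfolding nu_def by (rule Least_le)
qed (simp add: derivative_above_nu W)

text \<open>Being an accumulation point is a local property, so derived sets commute with
  restriction to an open set.\<close>

lemma derivative_subtopology_open:
  assumes X: "openin W X"
  shows "derivative (subtopology W X) \<xi> = X \<inter> derivative W \<xi>"
proof (induction \<xi> rule: less_induct)
  case (less \<xi>)
  consider "\<xi> = 0" | \<zeta> where "\<xi> = osucc \<zeta>" | "\<xi> \<noteq> 0" "\<not> is_osucc \<xi>"
    unfolding is_osucc_def by blast
  then show ?case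
  proof cases
    case 1
    then show ?thesis by (auto simp: derivative_zero)
  next
    case 2
    have "derivative (subtopology W X) \<xi> = X \<inter> W derived_set_of (X \<inter> derivative W \<zeta>)"
      using less.IH[of \<zeta>] by (simp add: 2 derivative_osucc derived_set_of_subtopology less_osucc)
    also have "\<dots> = X \<inter> derivative W \<xi>"
      using openin_Int_derived_set_of_eq[OF X] by (auto simp: 2 derivative_osucc)
    finally show ?thesis .
  next
    case 3
    \<comment> \<open>The intersection at a limit stage has a nonempty index set, so
      \<open>X\<close> can be moved out of it.\<close>
    then have "0 < \<xi>" by (simp add: order_less_le)
    then show ?thesis
      using less.IH by (auto simp: derivative_limit[OF 3])
  qed
qed

lemma perfect_kernel_subtopology_open:
  assumes W: "Hausdorff_space W" and X: "openin W X"
  shows "perfect_kernel (subtopology W X) = X \<inter> perfect_kernel W"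
proof -
  \<comment> \<open>The subspace may become stationary at another stage than \<open>W\<close>; from
    the maximum on, both have reached their kernels.\<close>
  let ?\<xi> = "max (nu W) (nu (subtopology W X))"
  have "perfect_kernel (subtopology W X) = derivative (subtopology W X) ?\<xi>"
    using derivative_above_nu[OF Hausdorff_space_subtopology[OF W]] by simp
  also have "\<dots> = X \<inter> perfect_kernel W"
    using derivative_above_nu[OF W] by (simp add: derivative_subtopology_open[OF X])
  finally show ?thesis .
qed

section \<open>Scattered parts, their closures and ranks\<close>

definition scattered_part :: "'a topology \<Rightarrow> 'a ordinal \<Rightarrow> 'a set" where
  "scattered_part W \<xi> = derivative W \<xi> - perfect_kernel W"

lemma scattered_part_antimono:
  "Hausdorff_space W \<Longrightarrow> \<eta> \<le> \<xi> \<Longrightarrow> scattered_part W \<xi> \<subseteq> scattered_part W \<eta>"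
  using derivative_antimono by (fastforce simp: scattered_part_def)

lemma scattered_part_eq_empty_iff:
  "Hausdorff_space W \<Longrightarrow> scattered_part W \<xi> = {} \<longleftrightarrow> nu W \<le> \<xi>"
  by (simp add: scattered_part_def nu_le_iff)

lemma scattered_part_subset_topspace: "Hausdorff_space W \<Longrightarrow> scattered_part W \<xi> \<subseteq> topspace W"
  using closedin_subset[OF closedin_derivative] by (fastforce simp: scattered_part_def)

lemma scattered_part_subtopology_open:
  assumes "Hausdorff_space W" "openin W X"
  shows "scattered_part (subtopology W X) \<xi> = X \<inter> scattered_part W \<xi>"
  using assms
  by (auto simp: scattered_part_def derivative_subtopology_open perfect_kernel_subtopology_open)

lemma closure_of_scattered_part_subtopology_open:
  assumes "Hausdorff_space W" "openin W X"
  shows "subtopology W X closure_of scattered_part (subtopology W X) \<xi>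
    = X \<inter> W closure_of scattered_part W \<xi>"
  using assms closure_of_subtopology_open[of W X] openin_Int_closure_of_eq[of W X "scattered_part W \<xi>"]
  by (simp add: scattered_part_subtopology_open)

text \<open>If an open set \<open>U\<close> misses the layer then the derivatives of the space \<open>U\<close> are stationary from
  \<open>\<xi>\<close> on, so \<open>U\<close> misses the scattered part as well.\<close>

lemma closure_of_layer:
  assumes W: "Hausdorff_space W"
  shows "W closure_of layer W \<xi> = W closure_of scattered_part W \<xi>"
proof
  show "W closure_of layer W \<xi> \<subseteq> W closure_of scattered_part W \<xi>"
    using perfect_kernel_subset_derivative[OF W]
    by (intro closure_of_mono) (auto simp: layer_def scattered_part_def)
  have "scattered_part W \<xi> \<subseteq> W closure_of layer W \<xi>"
  proof
    fix x assume x: "x \<in> scattered_part W \<xi>"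
    have "\<exists>y. y \<in> layer W \<xi> \<and> y \<in> U" if U: "x \<in> U" "openin W U" for U
    proof (rule ccontr)
      assume "\<not> ?thesis"
      then have "U \<inter> derivative W \<xi> \<subseteq> U \<inter> derivative W (osucc \<xi>)"
        by (auto simp: layer_def)
      then have "U \<inter> derivative W \<xi> = U \<inter> derivative W (osucc \<xi>)"
        using derivative_antimono[OF W less_imp_le[OF less_osucc]] by blast
      then have "derivative (subtopology W U) \<xi> = perfect_kernel (subtopology W U)"
        by (intro derivative_stationary_eq_perfect_kernel Hausdorff_space_subtopology W)
          (simp add: derivative_subtopology_open U)
      then have "U \<inter> derivative W \<xi> = U \<inter> perfect_kernel W"
        by (simp add: derivative_subtopology_open perfect_kernel_subtopology_open U W)
      then show False
        using x U(1) by (auto simp: scattered_part_def)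
    qed
    then show "x \<in> W closure_of layer W \<xi>"
      using x scattered_part_subset_topspace[OF W] by (auto simp: in_closure_of)
  qed
  then show "W closure_of scattered_part W \<xi> \<subseteq> W closure_of layer W \<xi>"
    by (simp add: closure_of_minimal)
qed

lemma closure_of_scattered_part_antimono:
  "Hausdorff_space W \<Longrightarrow> \<eta> \<le> \<xi> \<Longrightarrow> W closure_of scattered_part W \<xi> \<subseteq> W closure_of scattered_part W \<eta>"
  by (intro closure_of_mono scattered_part_antimono)

text \<open>The closures decrease with the index, so the least index at which \<open>x\<close>
  leaves them is a threshold. Such an index exists because the scattered part at \<open>nu W\<close>
  is empty.\<close>

lemma less_rnk_iff:
  assumes W: "Hausdorff_space W"
  shows "\<xi> < rnk W x \<longleftrightarrow> x \<in> W closure_of scattered_part W \<xi>"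
proof
  show "x \<in> W closure_of scattered_part W \<xi>" if "\<xi> < rnk W x"
    using that not_less_Least unfolding rnk_def scattered_part_def by blast
  assume *: "x \<in> W closure_of scattered_part W \<xi>"
  have "x \<notin> W closure_of scattered_part W (nu W)"
    using scattered_part_eq_empty_iff[OF W, of "nu W"] by simp
  then have "x \<notin> W closure_of scattered_part W (rnk W x)"
    unfolding rnk_def scattered_part_def by (rule LeastI)
  then show "\<xi> < rnk W x"
    using * closure_of_scattered_part_antimono[OF W, of "rnk W x" \<xi>] by force
qed

lemma rnk_subtopology_open:
  assumes W: "Hausdorff_space W" and X: "openin W X" "x \<in> X"
  shows "rnk (subtopology W X) x = rnk W x"
proof -
  have "\<xi> < rnk (subtopology W X) x \<longleftrightarrow> \<xi> < rnk W x" for \<xi>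
    using X(2) by (simp add: less_rnk_iff W Hausdorff_space_subtopology
        closure_of_scattered_part_subtopology_open[OF W X(1)])
  then show ?thesis
    by (metis less_irrefl linorder_neqE)
qed

lemma perfect_kernel_above_eq:
  assumes "Hausdorff_space W"
  shows "perfect_kernel_above W \<xi> = perfect_kernel W \<inter> W closure_of scattered_part W \<xi>"
  by (auto simp: perfect_kernel_above_def less_rnk_iff assms)

lemma closedin_perfect_kernel: "Hausdorff_space W \<Longrightarrow> closedin W (perfect_kernel W)"
  by (simp add: closedin_derivative perfect_kernel_def)

text \<open>The closure of a scattered part stays inside the closed derivative, so the only points
  it can gain lie in the kernel.\<close>

lemma closedin_scattered_part_iff:
  assumes W: "Hausdorff_space W"
  shows "closedin W (scattered_part W \<xi>) \<longleftrightarrow> perfect_kernel_above W \<xi> = {}"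
proof
  assume "closedin W (scattered_part W \<xi>)"
  then show "perfect_kernel_above W \<xi> = {}"
    by (auto simp: perfect_kernel_above_eq W closure_of_closedin) (simp add: scattered_part_def)
next
  assume "perfect_kernel_above W \<xi> = {}"
  moreover have "W closure_of scattered_part W \<xi> \<subseteq> derivative W \<xi>"
    by (rule closure_of_minimal) (auto simp: scattered_part_def closedin_derivative W)
  ultimately have "W closure_of scattered_part W \<xi> \<subseteq> scattered_part W \<xi>"
    by (auto simp: perfect_kernel_above_eq W scattered_part_def)
  then show "closedin W (scattered_part W \<xi>)"
    using closure_of_subset[OF scattered_part_subset_topspace[OF W]] by (metis closure_of_eq subset_antisym)
qed

section \<open>The invariants as thresholds\<close>

lemma lam_eq:
  assumes "Hausdorff_space W"
  shows "lam W = (LEAST \<xi>. perfect_kernel_above W \<xi> = {})"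
  by (simp add: lam_def closedin_scattered_part_iff[OF assms] flip: scattered_part_def)

lemma rho_eq:
  assumes "Hausdorff_space W"
  shows "rho W = (LEAST \<xi>. compactin W (W closure_of scattered_part W \<xi>))"
  by (simp add: rho_def closure_of_layer[OF assms])

lemma perfect_kernel_above_nu:
  "Hausdorff_space W \<Longrightarrow> perfect_kernel_above W (nu W) = {}"
  using scattered_part_eq_empty_iff[of W "nu W"] by (simp add: perfect_kernel_above_eq)

lemma perfect_kernel_above_lam:
  assumes W: "Hausdorff_space W"
  shows "perfect_kernel_above W (lam W) = {}"
  unfolding lam_eq[OF W] using perfect_kernel_above_nu[OF W] by (rule LeastI)

lemma lam_le_nu:
  assumes W: "Hausdorff_space W"
  shows "lam W \<le> nu W"
  unfolding lam_eq[OF W] using perfect_kernel_above_nu[OF W] by (rule Least_le)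

lemma compactin_perfect_kernel_above_rho_U:
  assumes W: "Hausdorff_space W"
  shows "compactin W (perfect_kernel_above W (rho_U W))"
  unfolding rho_U_def by (rule LeastI[of _ "nu W"]) (simp add: perfect_kernel_above_nu[OF W])

lemma rho_U_le_lam:
  assumes W: "Hausdorff_space W"
  shows "rho_U W \<le> lam W"
  unfolding rho_U_def by (rule Least_le) (simp add: perfect_kernel_above_lam[OF W])

lemma compactin_scattered_part_iff:
  assumes W: "Hausdorff_space W"
  shows "compactin W (W closure_of scattered_part W \<xi>) \<longleftrightarrow> rho W \<le> \<xi>"
proof
  show "compactin W (W closure_of scattered_part W \<xi>) \<Longrightarrow> rho W \<le> \<xi>"
    unfolding rho_eq[OF W] by (rule Least_le)
  have "compactin W (W closure_of scattered_part W (rho W))"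
    unfolding rho_eq[OF W]
    by (rule LeastI[of _ "nu W"]) (simp add: scattered_part_eq_empty_iff[OF W, THEN iffD2])
  then show "rho W \<le> \<xi> \<Longrightarrow> compactin W (W closure_of scattered_part W \<xi>)"
    by (rule closed_compactin[OF _ closure_of_scattered_part_antimono[OF W] closedin_closure_of])
qed

text \<open>The kernel is closed, so it meets a compact closure of a scattered part in a compact
  set.\<close>

lemma rho_U_le_rho:
  assumes W: "Hausdorff_space W"
  shows "rho_U W \<le> rho W"
proof -
  have "compactin W (perfect_kernel_above W (rho W))"
    using compactin_scattered_part_iff[OF W, of "rho W"] closedin_perfect_kernel[OF W]
    by (simp add: perfect_kernel_above_eq[OF W] closed_Int_compactin)
  then show ?thesis
    unfolding rho_U_def by (rule Least_le)
qed

text \<open>This reads the \<open>rho\<close> of an open piece off compactness in \<open>W\<close>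
  itself, so that pieces can be compared with each other and with \<open>W\<close>.\<close>

lemma compactin_scattered_part_subtopology_open_iff:
  assumes W: "Hausdorff_space W" and X: "openin W X"
  shows "compactin W (X \<inter> W closure_of scattered_part W \<xi>) \<longleftrightarrow> rho (subtopology W X) \<le> \<xi>"
  unfolding compactin_scattered_part_iff[OF Hausdorff_space_subtopology[OF W], symmetric]
    closure_of_scattered_part_subtopology_open[OF W X] compactin_subtopology
  by simp

section \<open>Invariants of the two clopen pieces\<close>

text \<open>Ranks are local and \<open>X\<close> contains the whole kernel, so \<open>lam\<close>
  and \<open>rho_U\<close> do not change. The assumptions on \<open>X\<close> bound
  \<open>nu\<close> by \<open>lam\<close> and \<open>rho\<close> by \<open>rho_U\<close>; the
  reverse inequalities hold in every Hausdorff space.\<close>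

lemma strongly_uniform_subtopology:
  assumes W: "Hausdorff_space W" and X: "openin W X"
    and K: "perfect_kernel W \<subseteq> X" and L: "X \<inter> scattered_part W (lam W) = {}"
    and C: "compactin W (X \<inter> W closure_of scattered_part W (rho_U W))"
  shows "strongly_uniform (subtopology W X)"
    and "perfect_kernel (subtopology W X) = perfect_kernel W"
proof -
  let ?X = "subtopology W X"
  have H: "Hausdorff_space ?X"
    by (rule Hausdorff_space_subtopology[OF W])
  show PK: "perfect_kernel ?X = perfect_kernel W"
    using K by (auto simp: perfect_kernel_subtopology_open[OF W X])
  have above: "perfect_kernel_above ?X \<xi> = perfect_kernel_above W \<xi>" for \<xi>
    unfolding perfect_kernel_above_def PK using K rnk_subtopology_open[OF W X] by auto
  have lam: "lam ?X = lam W"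
    by (simp add: lam_eq H W above)
  have "perfect_kernel_above W \<xi> \<subseteq> X" for \<xi>
    using K by (auto simp: perfect_kernel_above_def)
  then have rho_U: "rho_U ?X = rho_U W"
    by (simp add: rho_U_def above compactin_subtopology)
  have "nu ?X \<le> lam W"
    using L scattered_part_eq_empty_iff[OF H, of "lam W"] scattered_part_subtopology_open[OF W X] by simp
  then have "uniform ?X"
    unfolding uniform_def using lam_le_nu[OF H] lam by simp
  moreover have "rho ?X \<le> rho_U W"
    using C compactin_scattered_part_subtopology_open_iff[OF W X] by blast
  then have "rho_U ?X = rho ?X"
    using rho_U_le_rho[OF H] rho_U by simp
  ultimately show "strongly_uniform ?X"
    by (simp add: strongly_uniform_def)
qed

lemma ranked_homeomorphic_subtopology:
  assumes W: "Hausdorff_space W" and X: "openin W X"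
    and PK: "perfect_kernel (subtopology W X) = perfect_kernel W"
  shows "ranked_homeomorphic
      (subtopology (subtopology W X) (perfect_kernel (subtopology W X))) (rnk (subtopology W X))
      (subtopology W (perfect_kernel W)) (rnk W)"
proof -
  have "perfect_kernel W \<subseteq> X"
    using PK perfect_kernel_subtopology_open[OF W X] by blast
  then have "subtopology (subtopology W X) (perfect_kernel W) = subtopology W (perfect_kernel W)"
    by (simp add: subtopology_subtopology inf.absorb2)
  then show ?thesis
    unfolding ranked_homeomorphic_def PK
    by (intro exI[of _ id]) (auto simp: rnk_subtopology_open[OF W X] dest!: subsetD[OF \<open>perfect_kernel W \<subseteq> X\<close>])
qed

text \<open>From index \<open>lam W\<close> on, all scattered parts of \<open>W\<close> lie in
  \<open>Y\<close>. As \<open>lam W\<close> is below \<open>nu W\<close>, this range contains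
  everything that determines \<open>nu\<close> and \<open>top_count\<close>.\<close>

lemma scattered_complement:
  assumes W: "Hausdorff_space W" and Y: "openin W Y" and K: "Y \<inter> perfect_kernel W = {}"
    and L: "scattered_part W (lam W) \<subseteq> Y" and lt: "lam W < nu W"
  shows "scattered (subtopology W Y)" "nu (subtopology W Y) = nu W"
    "top_count (subtopology W Y) = top_count W"
proof -
  let ?Y = "subtopology W Y"
  have H: "Hausdorff_space ?Y"
    by (rule Hausdorff_space_subtopology[OF W])
  have PK: "perfect_kernel ?Y = {}"
    using K by (auto simp: perfect_kernel_subtopology_open[OF W Y])
  then show "scattered ?Y"
    by (simp add: scattered_def)
  have eq: "scattered_part ?Y \<xi> = scattered_part W \<xi>" if "lam W \<le> \<xi>" for \<xi>
    using scattered_part_antimono[OF W that] L scattered_part_subtopology_open[OF W Y] by auto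
  have "nu ?Y \<le> nu W"
    using scattered_part_eq_empty_iff[OF H] scattered_part_eq_empty_iff[OF W] eq lam_le_nu[OF W] by blast
  moreover have "nu W \<le> nu ?Y"
  proof (cases "lam W \<le> nu ?Y")
    case True
    then show ?thesis
      using scattered_part_eq_empty_iff[OF H] scattered_part_eq_empty_iff[OF W] eq by blast
  next
    case False
    \<comment> \<open>If \<open>nu\<close> of \<open>Y\<close> were below \<open>lam W\<close>, the
      scattered part at \<open>lam W\<close> would be empty in \<open>Y\<close>, hence in
      \<open>W\<close>, against \<open>lam W < nu W\<close>.\<close>
    then have "scattered_part ?Y (lam W) = {}"
      using scattered_part_eq_empty_iff[OF H] by simp
    then show ?thesis
      using eq[of "lam W"] scattered_part_eq_empty_iff[OF W] lt by simp
  qed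
  ultimately show nu: "nu ?Y = nu W" by simp
  have "derivative ?Y (opred (nu W)) - perfect_kernel ?Y = derivative W (opred (nu W)) - perfect_kernel W"
    if suc: "is_osucc (nu W)"
  proof -
    obtain \<mu> where \<mu>: "nu W = osucc \<mu>"
      using suc unfolding is_osucc_def by blast
    then have "lam W \<le> \<mu>"
      using lt by (metis not_le osucc_le)
    then show ?thesis
      using eq \<mu> by (simp add: scattered_part_def)
  qed
  then show "top_count ?Y = top_count W"
    unfolding top_count_def nu by auto
qed

lemma rho_zero:
  assumes "Hausdorff_space W" "compact_space W"
  shows "rho W = 0"
  using compactin_scattered_part_iff[OF assms(1), of 0] closedin_compact_space[OF assms(2)] by simp

text \<open>At the larger of the two \<open>rho\<close> values of the pieces, both halves of the
  closure are compact, hence so is their union. Therefore the pieces cannot both have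
  \<open>rho\<close> below that of \<open>W\<close>.\<close>

lemma rho_complement:
  assumes W: "Hausdorff_space W" and XY: "openin W X" "openin W Y" "closedin W Y" "X \<union> Y = topspace W"
    and C: "rho (subtopology W X) < rho W"
  shows "rho (subtopology W Y) = rho W"
proof (rule antisym)
  show "rho (subtopology W Y) \<le> rho W"
    using compactin_scattered_part_subtopology_open_iff[OF W XY(2), of "rho W"]
      compactin_scattered_part_iff[OF W, of "rho W"] XY(3)
    by (simp add: closed_Int_compactin)
  show "rho W \<le> rho (subtopology W Y)"
  proof (rule ccontr)
    let ?\<xi> = "max (rho (subtopology W X)) (rho (subtopology W Y))"
    let ?F = "W closure_of scattered_part W ?\<xi>"
    assume "\<not> ?thesis"
    then have "\<not> rho W \<le> ?\<xi>" using C by (simp add: le_max_iff_disj)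
    moreover have "compactin W ((X \<inter> ?F) \<union> (Y \<inter> ?F))"
      using compactin_scattered_part_subtopology_open_iff[OF W XY(1), of ?\<xi>]
        compactin_scattered_part_subtopology_open_iff[OF W XY(2), of ?\<xi>]
      by (intro compactin_Un) auto
    moreover have "(X \<inter> ?F) \<union> (Y \<inter> ?F) = ?F"
      using XY(4) closure_of_subset_topspace[of W "scattered_part W ?\<xi>"] by blast
    ultimately show False
      using compactin_scattered_part_iff[OF W, of ?\<xi>] by metis
  qed
qed

section \<open>The decomposition\<close>

theorem theorem9:
  fixes W :: "'a topology"
  assumes "omega_Stone_space W"
    and "\<not> uniform W"
    and "\<not> scattered W"
  shows "\<exists>X Y.
    openin W X \<and> closedin W X \<and> openin W Y \<and> closedin W Y \<and>
    X \<inter> Y = {} \<and> X \<union> Y = topspace W \<and>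
    strongly_uniform (subtopology W X) \<and>
    ranked_homeomorphic
      (subtopology (subtopology W X) (perfect_kernel (subtopology W X))) (rnk (subtopology W X))
      (subtopology W (perfect_kernel W)) (rnk W) \<and>
    (rho_U W = rho W \<and> rho W < nu W \<longrightarrow>
      has_scattered_type (subtopology W Y) (Type_Triple (nu W) 0 (top_count W))) \<and>
    (rho_U W < rho W \<and> rho W = nu W \<longrightarrow>
      has_scattered_type (subtopology W Y) (Type_Pair (nu W) (nu W))) \<and>
    (rho_U W < rho W \<and> rho W < nu W \<longrightarrow>
      has_scattered_type (subtopology W Y) (Type_Triple (nu W) (rho W) (top_count W)))"
proof -
  have W: "Hausdorff_space W"
    using assms(1) by (simp add: omega_Stone_space_def)
  have lt: "lam W < nu W"
    using assms(2) lam_le_nu[OF W] by (simp add: uniform_def)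
  let ?K = "perfect_kernel W" and ?L = "scattered_part W (lam W)"
  let ?F = "W closure_of scattered_part W (rho_U W)"
  have K: "closedin W ?K"
    by (rule closedin_perfect_kernel[OF W])
  have L: "closedin W ?L"
    using closedin_scattered_part_iff[OF W] perfect_kernel_above_lam[OF W] by simp
  have KL: "?K \<inter> ?L = {}"
    by (auto simp: scattered_part_def)
  have "\<exists>X. openin W X \<and> closedin W X \<and> ?K \<subseteq> X \<and> X \<inter> ?L = {} \<and> compactin W (X \<inter> ?F) \<and>
      (rho_U W = rho W \<longrightarrow> compactin W (topspace W - X))"
  proof (cases "rho_U W = rho W")
    case True
    then have F: "compactin W ?F"
      using compactin_scattered_part_iff[OF W] by simp
    \<comment> \<open>This holds because \<open>rho_U W\<close> is at most \<open>lam W\<close>; it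
      makes the closed set \<open>?L\<close> compact.\<close>
    have "?L \<subseteq> ?F"
      using scattered_part_antimono[OF W rho_U_le_lam[OF W]]
        closure_of_subset[OF scattered_part_subset_topspace[OF W]] by blast
    then have "compactin W ?L"
      using F L closed_compactin by blast
    moreover have "openin W (topspace W - ?K)" "?L \<subseteq> topspace W - ?K"
      using K KL scattered_part_subset_topspace[OF W] by auto
    ultimately obtain Y where Y: "openin W Y" "compactin W Y" "?L \<subseteq> Y" "Y \<subseteq> topspace W - ?K"
      using omega_Stone_compact_open_between[OF assms(1)] by metis
    have clY: "closedin W Y"
      by (rule compactin_imp_closedin[OF W Y(2)])
    have clX: "closedin W (topspace W - Y)"
      using Y(1) by blast
    have "topspace W - (topspace W - Y) = Y"
      using closedin_subset[OF clY] by blast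
    then show ?thesis
      using Y clX clY closedin_subset[OF K] closed_Int_compactin[OF clX F]
      by (intro exI[of _ "topspace W - Y"]) auto
  next
    case False
    have "compactin W (?K \<inter> ?F)"
      using compactin_perfect_kernel_above_rho_U[OF W] perfect_kernel_above_eq[OF W] by simp
    then obtain V where V: "openin W V" "compactin W V" "?K \<inter> ?F \<subseteq> V"
      using omega_Stone_compact_open_between[OF assms(1), of _ "topspace W"] compactin_subset_topspace
      by (metis openin_topspace)
    have B: "closedin W (?L \<union> (?F - V))"
      by (intro closedin_Un L closedin_diff closedin_closure_of V(1))
    have KB: "?K \<inter> (?L \<union> (?F - V)) = {}"
      using KL V(3) by blast
    obtain X where X: "openin W X" "closedin W X" "?K \<subseteq> X" "X \<inter> (?L \<union> (?F - V)) = {}"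
      using omega_Stone_clopen_separation[OF assms(1) K B KB] by blast
    \<comment> \<open>As \<open>X\<close> misses \<open>?F - V\<close>, the closed set
      \<open>X \<inter> ?F\<close> lies in the compact set \<open>V\<close>.\<close>
    have "compactin W (X \<inter> ?F)"
      using X V by (intro closed_compactin[OF V(2)]) auto
    then show ?thesis
      using X False by blast
  qed
  then obtain X where X: "openin W X" "closedin W X" "?K \<subseteq> X" "X \<inter> ?L = {}" "compactin W (X \<inter> ?F)"
      and XC: "rho_U W = rho W \<longrightarrow> compactin W (topspace W - X)"
    by blast
  define Y where "Y = topspace W - X"
  have Y: "openin W Y" "closedin W Y" "X \<inter> Y = {}" "X \<union> Y = topspace W"
    using X closedin_subset[OF X(2)] by (auto simp: Y_def)
  note SU = strongly_uniform_subtopology[OF W X(1,3,4,5)]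
  have "Y \<inter> ?K = {}" "?L \<subseteq> Y"
    using X Y(3) scattered_part_subset_topspace[OF W, of "lam W"] by (auto simp: Y_def)
  note SC = scattered_complement[OF W Y(1) this lt]
  have "rho (subtopology W Y) = 0" if "rho_U W = rho W"
    using that XC by (intro rho_zero Hausdorff_space_subtopology W compact_space_subtopology) (simp add: Y_def)
  \<comment> \<open>Compactness of \<open>X \<inter> ?F\<close> bounds the \<open>rho\<close> of
    \<open>X\<close> by \<open>rho_U W\<close>, which is strictly below
    \<open>rho W\<close>.\<close>
  moreover have "rho (subtopology W Y) = rho W" if "rho_U W < rho W"
    using that X(5) compactin_scattered_part_subtopology_open_iff[OF W X(1), of "rho_U W"]
    by (intro rho_complement[OF W X(1) Y(1,2,4)]) simp
  \<comment> \<open>This separates \<open>nu\<close> from the value 0 of \<open>rho\<close> on a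
    compact \<open>Y\<close>, so that \<open>scattered_type\<close> yields a triple there and not a
    pair.\<close>
  moreover have "nu W \<noteq> 0"
    using lt by (metis not_less ordinal_zero_le)
  ultimately have "(rho_U W = rho W \<and> rho W < nu W \<longrightarrow>
      has_scattered_type (subtopology W Y) (Type_Triple (nu W) 0 (top_count W))) \<and>
    (rho_U W < rho W \<and> rho W = nu W \<longrightarrow>
      has_scattered_type (subtopology W Y) (Type_Pair (nu W) (nu W))) \<and>
    (rho_U W < rho W \<and> rho W < nu W \<longrightarrow>
      has_scattered_type (subtopology W Y) (Type_Triple (nu W) (rho W) (top_count W)))"
    using SC by (auto simp: has_scattered_type_def scattered_type_def)
  then show ?thesis
    using X Y SU(1) ranked_homeomorphic_subtopology[OF W X(1) SU(2)] by blast
qed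

end
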